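(* Let $G$ be an abelian group (written additively) and let $\alpha\in\mathrm{Aut}(G)$ satisfy $\alpha^2=1$. Define a new binary operation on the set $G$ by $a\cdot b:=\alpha(a)+b$. Then $G_\alpha=(G,\cdot)$ is an AG-group. Furthermore, every AG-group is obtainable in this way, i.e. every AG-group equals $G_\alpha$ for some abelian group $G$ and some $\alpha\in\mathrm{Aut}(G)$ with $\alpha^2=1$. Finally, given abelian groups $G,H$ and automorphisms $\alpha\in\mathrm{Aut}(G)$, $\beta\in\mathrm{Aut}(H)$ with $\alpha^2=1$ and $\beta^2=1$, the AG-groups $G_\alpha$ and $H_\beta$ are isomorphic if and only if the abelian groups $G$ and $H$ are isomorphic and the automorphisms $\alpha$ and $\beta$ are conjugate, i.e. there is a group isomorphism $\pi:G\to H$ with $\pi\alpha\pi^{-1}=\beta$.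
   Context: An AG-group is a set $G$ with a binary operation (written as juxtaposition) that satisfies the left invertive law $(xy)z=(zy)x$ for all $x,y,z\in G$, has a left identity $e$ (so $ex=x$ for all $x\in G$), and has left inverses (for every $x\in G$ there is $x^{-1}\in G$ with $x^{-1}x=e$). An isomorphism of AG-groups is a bijection preserving the binary operation. The automorphism $\alpha$ is allowed to be the identity. *)

theory Defs
  imports "HOL-Algebra.Algebra"
begin

locale ag_group =
  fixes A :: "'a set" and m :: "'a \<Rightarrow> 'a \<Rightarrow> 'a" (infixl "\<cdot>" 70)
  assumes closed: "\<lbrakk>x \<in> A; y \<in> A\<rbrakk> \<Longrightarrow> x \<cdot> y \<in> A"
    and left_invertive: "\<lbrakk>x \<in> A; y \<in> A; z \<in> A\<rbrakk> \<Longrightarrow> (x \<cdot> y) \<cdot> z = (z \<cdot> y) \<cdot> x"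
    and left_identity_inverses:
      "\<exists>e\<in>A. (\<forall>x\<in>A. e \<cdot> x = x) \<and> (\<forall>x\<in>A. \<exists>y\<in>A. y \<cdot> x = e)"

definition ag_isomorphic ::
  "'a set \<Rightarrow> ('a \<Rightarrow> 'a \<Rightarrow> 'a) \<Rightarrow> 'b set \<Rightarrow> ('b \<Rightarrow> 'b \<Rightarrow> 'b) \<Rightarrow> bool" where
  "ag_isomorphic A m B n \<longleftrightarrow>
    (\<exists>f. bij_betw f A B \<and> (\<forall>x\<in>A. \<forall>y\<in>A. f (m x y) = n (f x) (f y)))"

(* Groups of HOL-Algebra are written multiplicatively, so the additive
   formula alpha(a) + b becomes the following. *)
definition twist :: "('a, 'c) monoid_scheme \<Rightarrow> ('a \<Rightarrow> 'a) \<Rightarrow> 'a \<Rightarrow> 'a \<Rightarrow> 'a" where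
  "twist G \<alpha> a b = \<alpha> a \<otimes>\<^bsub>G\<^esub> b"

(* The elements of auto G are extensional (undefined outside the carrier),
   so the condition on the carrier says exactly that the square is the identity of Aut(G). *)
definition involutive_auto :: "('a, 'c) monoid_scheme \<Rightarrow> ('a \<Rightarrow> 'a) \<Rightarrow> bool" where
  "involutive_auto G \<alpha> \<longleftrightarrow> \<alpha> \<in> auto G \<and> (\<forall>x\<in>carrier G. \<alpha> (\<alpha> x) = x)"

definition conjugate_autos ::
  "('a, 'c) monoid_scheme \<Rightarrow> ('a \<Rightarrow> 'a) \<Rightarrow> ('b, 'd) monoid_scheme \<Rightarrow> ('b \<Rightarrow> 'b) \<Rightarrow> bool" where
  "conjugate_autos G \<alpha> H \<beta> \<longleftrightarrow>
    (\<exists>\<pi>\<in>iso G H. \<forall>y\<in>carrier H. \<pi> (\<alpha> (inv_into (carrier G) \<pi> y)) = \<beta> y)"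

end

theory Submission
  imports Defs
begin

text \<open>
  In \<open>G\<^sub>\<alpha>\<close> the product \<open>(a \<cdot> b) \<cdot> c\<close> is \<open>\<alpha> (\<alpha> a + b) + c = a + \<alpha> b + c\<close>, because \<open>\<alpha>\<close> is an
  involution; this is symmetric in \<open>a\<close> and \<open>c\<close>, which is the left invertive law.

  Conversely, in \<open>G\<^sub>\<alpha>\<close> one has \<open>\<alpha> a = a \<cdot> 0\<close> and \<open>a + b = \<alpha> a \<cdot> b\<close>, so the twist remembers both
  the involution and the group. In an AG-group with left identity \<open>e\<close> the only possible choice is
  therefore \<open>\<alpha> a = a e\<close> and \<open>a + b = (a e) b\<close>. That this works rests on two instances of the left
  invertive law, \<open>(a e) b = (b e) a\<close> (commutativity) and \<open>(a e) e = a\<close> (\<open>\<alpha>\<close> is an involution),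
  and on left permutability \<open>a (b c) = b (a c)\<close>, which follows from the medial law and yields
  associativity and additivity of \<open>\<alpha>\<close>.

  For the same reason an isomorphism between twists that maps \<open>0\<close> to \<open>0\<close> respects \<open>\<alpha>\<close> and \<open>+\<close>;
  the neutral element is preserved because it is the only idempotent of the twist.
\<close>

section \<open>Twists of abelian groups\<close>

lemma involutive_autoD:
  assumes "involutive_auto G \<alpha>"
  shows "\<alpha> \<in> hom G G" "\<And>x. x \<in> carrier G \<Longrightarrow> \<alpha> x \<in> carrier G"
    "\<And>x. x \<in> carrier G \<Longrightarrow> \<alpha> (\<alpha> x) = x"
    "\<And>x y. x \<in> carrier G \<Longrightarrow> y \<in> carrier G \<Longrightarrow> \<alpha> (x \<otimes>\<^bsub>G\<^esub> y) = \<alpha> x \<otimes>\<^bsub>G\<^esub> \<alpha> y"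
  using assms by (auto simp: involutive_auto_def auto_def hom_def)

lemma involutive_auto_one:
  assumes "group G" "involutive_auto G \<alpha>"
  shows "\<alpha> \<one>\<^bsub>G\<^esub> = \<one>\<^bsub>G\<^esub>"
  using assms(1) hom_one[OF involutive_autoD(1)[OF assms(2)]] by blast

text \<open>The left inverse of \<open>x\<close> in the twist is \<open>\<alpha> (- x)\<close>.\<close>

lemma ag_group_twist:
  assumes "comm_group G" "involutive_auto G \<alpha>"
  shows "ag_group (carrier G) (twist G \<alpha>)"
proof -
  interpret comm_group G by fact
  note \<alpha> = involutive_autoD[OF assms(2)] involutive_auto_one[OF is_group assms(2)]
  show ?thesis
  proof
    fix x y assume "x \<in> carrier G" "y \<in> carrier G"
    then show "twist G \<alpha> x y \<in> carrier G"
      by (simp add: twist_def \<alpha>)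
  next
    fix x y z assume "x \<in> carrier G" "y \<in> carrier G" "z \<in> carrier G"
    then show "twist G \<alpha> (twist G \<alpha> x y) z = twist G \<alpha> (twist G \<alpha> z y) x"
      by (simp add: twist_def \<alpha> m_ac)
  next
    have "\<exists>y\<in>carrier G. twist G \<alpha> y x = \<one>\<^bsub>G\<^esub>" if "x \<in> carrier G" for x
      using that by (intro bexI[of _ "\<alpha> (inv\<^bsub>G\<^esub> x)"]) (simp_all add: twist_def \<alpha>)
    moreover have "twist G \<alpha> \<one>\<^bsub>G\<^esub> x = x" if "x \<in> carrier G" for x
      using that by (simp add: twist_def \<alpha>)
    ultimately show "\<exists>e\<in>carrier G. (\<forall>x\<in>carrier G. twist G \<alpha> e x = x) \<and>
        (\<forall>x\<in>carrier G. \<exists>y\<in>carrier G. twist G \<alpha> y x = e)"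
      by blast
  qed
qed

section \<open>Recovering the abelian group from an AG-group\<close>

\<comment> \<open>The dot is wanted for the operation of the AG-group, not for products of ideals.\<close>
no_notation ideal_prod (infixl \<open>\<cdot>\<index>\<close> 80)

context ag_group
begin

lemma medial:
  assumes "a \<in> A" "b \<in> A" "c \<in> A" "d \<in> A"
  shows "(a \<cdot> b) \<cdot> (c \<cdot> d) = (a \<cdot> c) \<cdot> (b \<cdot> d)"
proof -
  have "(a \<cdot> b) \<cdot> (c \<cdot> d) = ((c \<cdot> d) \<cdot> b) \<cdot> a"
    using assms closed left_invertive[of a b "c \<cdot> d"] by simp
  also have "\<dots> = ((b \<cdot> d) \<cdot> c) \<cdot> a"
    using assms left_invertive[of c d b] by simp
  also have "\<dots> = (a \<cdot> c) \<cdot> (b \<cdot> d)"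
    using assms closed left_invertive[of "b \<cdot> d" c a] by simp
  finally show ?thesis .
qed

text \<open>Left permutability is the medial law with the first factors \<open>a\<close> and \<open>b\<close> written as
  \<open>e a\<close> and \<open>e b\<close>.\<close>

lemma left_permutable:
  assumes "e \<in> A" "\<And>x. x \<in> A \<Longrightarrow> e \<cdot> x = x" "a \<in> A" "b \<in> A" "c \<in> A"
  shows "a \<cdot> (b \<cdot> c) = b \<cdot> (a \<cdot> c)"
  using medial[of e a b c] assms by simp

lemma ex_comm_group_twist:
  "\<exists>(G :: 'a monoid) \<alpha>. comm_group G \<and> involutive_auto G \<alpha> \<and>
     carrier G = A \<and> (\<forall>a\<in>A. \<forall>b\<in>A. a \<cdot> b = twist G \<alpha> a b)"
proof -
  obtain e where e: "e \<in> A" "\<And>x. x \<in> A \<Longrightarrow> e \<cdot> x = x"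
    and inv: "\<And>x. x \<in> A \<Longrightarrow> \<exists>y\<in>A. y \<cdot> x = e"
    using left_identity_inverses by blast
  note perm = left_permutable[OF e]
  have invol: "(a \<cdot> e) \<cdot> e = a" if "a \<in> A" for a
    using that e left_invertive[of a e e] by simp
  have comm: "(a \<cdot> e) \<cdot> b = (b \<cdot> e) \<cdot> a" if "a \<in> A" "b \<in> A" for a b
    using that e left_invertive by blast
  have assoc: "(((a \<cdot> e) \<cdot> b) \<cdot> e) \<cdot> c = (a \<cdot> e) \<cdot> ((b \<cdot> e) \<cdot> c)"
    if "a \<in> A" "b \<in> A" "c \<in> A" for a b c
  proof -
    have "(((a \<cdot> e) \<cdot> b) \<cdot> e) \<cdot> c = (c \<cdot> e) \<cdot> ((a \<cdot> e) \<cdot> b)"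
      using that e comm closed by simp
    also have "\<dots> = (a \<cdot> e) \<cdot> ((c \<cdot> e) \<cdot> b)"
      using that e closed by (intro perm) auto
    also have "\<dots> = (a \<cdot> e) \<cdot> ((b \<cdot> e) \<cdot> c)"
      using that comm[of c b] by simp
    finally show ?thesis .
  qed
  have add: "((a \<cdot> e) \<cdot> b) \<cdot> e = ((a \<cdot> e) \<cdot> e) \<cdot> (b \<cdot> e)" if "a \<in> A" "b \<in> A" for a b
  proof -
    have "((a \<cdot> e) \<cdot> b) \<cdot> e = b \<cdot> (a \<cdot> e)"
      using that e closed left_invertive[of "a \<cdot> e" b e] by simp
    also have "\<dots> = ((a \<cdot> e) \<cdot> e) \<cdot> (b \<cdot> e)"
      using that e perm invol by simp
    finally show ?thesis .
  qed
  define G where "G = \<lparr>carrier = A, monoid.mult = (\<lambda>a b. (a \<cdot> e) \<cdot> b), one = e\<rparr>"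
  \<comment> \<open>Elements of \<^const>\<open>auto\<close> are extensional, hence the restriction.\<close>
  define \<alpha> where "\<alpha> = (\<lambda>a\<in>A. a \<cdot> e)"
  have "comm_group G"
  proof (rule comm_groupI)
    fix x assume "x \<in> carrier G"
    then have x: "x \<in> A" by (simp add: G_def)
    then obtain y where y: "y \<in> A" "y \<cdot> x = e"
      using inv by blast
    \<comment> \<open>The negative of \<open>x\<close> is \<open>\<alpha> y\<close> for the left inverse \<open>y\<close> of \<open>x\<close>.\<close>
    show "\<exists>z\<in>carrier G. z \<otimes>\<^bsub>G\<^esub> x = \<one>\<^bsub>G\<^esub>"
      using y e closed invol by (intro bexI[of _ "y \<cdot> e"]) (auto simp: G_def)
  qed (use e closed in \<open>auto simp: G_def assoc intro: comm\<close>)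
  moreover have "involutive_auto G \<alpha>"
  proof -
    have "bij_betw \<alpha> A A"
      by (rule bij_betw_byWitness[where f' = \<alpha>]) (use e closed invol in \<open>auto simp: \<alpha>_def\<close>)
    then show ?thesis
      using e closed invol add
      by (auto simp: involutive_auto_def auto_def hom_def Bij_def G_def \<alpha>_def)
  qed
  moreover have "a \<cdot> b = twist G \<alpha> a b" if "a \<in> A" "b \<in> A" for a b
    using that invol by (simp add: twist_def G_def \<alpha>_def)
  ultimately show ?thesis
    by (intro exI[of _ G] exI[of _ \<alpha>]) (simp add: G_def)
qed

end

section \<open>Isomorphisms of twists\<close>

text \<open>In additive notation, once \<open>f 0 = 0\<close> is known, comparing \<open>x \<cdot> 0\<close> with its image gives
  \<open>f (\<alpha> x) = \<beta> (f x)\<close>, and comparing \<open>\<alpha> x \<cdot> y = x + y\<close> with its image gives additivity.\<close>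

lemma twist_iso_imp_group_iso:
  assumes "comm_group G" "involutive_auto G \<alpha>" "comm_group H" "involutive_auto H \<beta>"
    and bij: "bij_betw f (carrier G) (carrier H)"
    and f: "\<And>x y. x \<in> carrier G \<Longrightarrow> y \<in> carrier G \<Longrightarrow> f (twist G \<alpha> x y) = twist H \<beta> (f x) (f y)"
  shows "f \<in> iso G H" "\<And>x. x \<in> carrier G \<Longrightarrow> f (\<alpha> x) = \<beta> (f x)"
proof -
  interpret G: comm_group G by fact
  interpret H: comm_group H by fact
  note \<alpha> = involutive_autoD[OF assms(2)] involutive_auto_one[OF G.is_group assms(2)]
  note \<beta> = involutive_autoD[OF assms(4)] involutive_auto_one[OF H.is_group assms(4)]
  have clo: "f x \<in> carrier H" if "x \<in> carrier G" for x
    using that bij by (auto simp: bij_betw_def)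
  have "\<beta> (f \<one>\<^bsub>G\<^esub>) \<otimes>\<^bsub>H\<^esub> f \<one>\<^bsub>G\<^esub> = f \<one>\<^bsub>G\<^esub>"
    using f[of "\<one>\<^bsub>G\<^esub>" "\<one>\<^bsub>G\<^esub>"] by (simp add: twist_def \<alpha>)
  then have "\<beta> (f \<one>\<^bsub>G\<^esub>) = \<one>\<^bsub>H\<^esub>"
    by (simp add: clo \<beta>)
  then have one: "f \<one>\<^bsub>G\<^esub> = \<one>\<^bsub>H\<^esub>"
    using \<beta>(3)[of "f \<one>\<^bsub>G\<^esub>"] clo \<beta>(5) by simp
  show comm: "f (\<alpha> x) = \<beta> (f x)" if "x \<in> carrier G" for x
    using that f[of x "\<one>\<^bsub>G\<^esub>"] by (simp add: twist_def \<alpha> \<beta> clo one)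
  have "f (x \<otimes>\<^bsub>G\<^esub> y) = f x \<otimes>\<^bsub>H\<^esub> f y" if "x \<in> carrier G" "y \<in> carrier G" for x y
    using that f[of "\<alpha> x" y] by (simp add: twist_def \<alpha> \<beta> clo comm)
  then show "f \<in> iso G H"
    using bij clo by (auto simp: iso_def hom_def)
qed

text \<open>Substituting \<open>y = \<pi> x\<close> removes the inverse of \<open>\<pi>\<close> from the definition of conjugacy; this form
  is the one that matches compatibility with the twisted operations.\<close>

lemma conjugate_autos_iff_intertwining:
  assumes "\<And>x. x \<in> carrier G \<Longrightarrow> \<alpha> x \<in> carrier G"
  shows "conjugate_autos G \<alpha> H \<beta> \<longleftrightarrow> (\<exists>\<pi>\<in>iso G H. \<forall>x\<in>carrier G. \<pi> (\<alpha> x) = \<beta> (\<pi> x))"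
proof -
  have "(\<forall>y\<in>carrier H. \<pi> (\<alpha> (inv_into (carrier G) \<pi> y)) = \<beta> y) \<longleftrightarrow>
      (\<forall>x\<in>carrier G. \<pi> (\<alpha> x) = \<beta> (\<pi> x))" if "\<pi> \<in> iso G H" for \<pi>
  proof -
    have "inj_on \<pi> (carrier G)" "carrier H = \<pi> ` carrier G"
      using that by (auto simp: iso_def bij_betw_def)
    then show ?thesis
      by simp
  qed
  then show ?thesis
    unfolding conjugate_autos_def by blast
qed

lemma ag_isomorphic_twist_iff:
  assumes "comm_group G" "involutive_auto G \<alpha>" "comm_group H" "involutive_auto H \<beta>"
  shows "ag_isomorphic (carrier G) (twist G \<alpha>) (carrier H) (twist H \<beta>) \<longleftrightarrow>
    conjugate_autos G \<alpha> H \<beta>"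
proof -
  note \<alpha> = involutive_autoD[OF assms(2)]
  have "ag_isomorphic (carrier G) (twist G \<alpha>) (carrier H) (twist H \<beta>) \<longleftrightarrow>
      (\<exists>\<pi>\<in>iso G H. \<forall>x\<in>carrier G. \<pi> (\<alpha> x) = \<beta> (\<pi> x))"
  proof
    assume "ag_isomorphic (carrier G) (twist G \<alpha>) (carrier H) (twist H \<beta>)"
    then show "\<exists>\<pi>\<in>iso G H. \<forall>x\<in>carrier G. \<pi> (\<alpha> x) = \<beta> (\<pi> x)"
      unfolding ag_isomorphic_def using twist_iso_imp_group_iso[OF assms] by metis
  next
    assume "\<exists>\<pi>\<in>iso G H. \<forall>x\<in>carrier G. \<pi> (\<alpha> x) = \<beta> (\<pi> x)"
    then show "ag_isomorphic (carrier G) (twist G \<alpha>) (carrier H) (twist H \<beta>)"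
      by (auto simp: ag_isomorphic_def twist_def iso_def hom_mult \<alpha>)
  qed
  then show ?thesis
    using conjugate_autos_iff_intertwining[of G \<alpha> H \<beta>] \<alpha>(2) by simp
qed

theorem theorem1:
  "(\<forall>(G :: 'a monoid) \<alpha>. comm_group G \<and> involutive_auto G \<alpha> \<longrightarrow>
      ag_group (carrier G) (twist G \<alpha>)) \<and>
   (\<forall>(A :: 'a set) m. ag_group A m \<longrightarrow>
      (\<exists>(G :: 'a monoid) \<alpha>. comm_group G \<and> involutive_auto G \<alpha> \<and>
         carrier G = A \<and> (\<forall>a\<in>A. \<forall>b\<in>A. m a b = twist G \<alpha> a b))) \<and>
   (\<forall>(G :: 'a monoid) (H :: 'b monoid) \<alpha> \<beta>.
      comm_group G \<and> involutive_auto G \<alpha> \<and> comm_group H \<and> involutive_auto H \<beta> \<longrightarrow>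
      (ag_isomorphic (carrier G) (twist G \<alpha>) (carrier H) (twist H \<beta>) \<longleftrightarrow>
       G \<cong> H \<and> conjugate_autos G \<alpha> H \<beta>))"
proof (intro conjI allI impI)
  fix G :: "'a monoid" and \<alpha>
  assume "comm_group G \<and> involutive_auto G \<alpha>"
  then show "ag_group (carrier G) (twist G \<alpha>)"
    using ag_group_twist by blast
next
  fix A :: "'a set" and m
  assume "ag_group A m"
  then show "\<exists>(G :: 'a monoid) \<alpha>. comm_group G \<and> involutive_auto G \<alpha> \<and>
      carrier G = A \<and> (\<forall>a\<in>A. \<forall>b\<in>A. m a b = twist G \<alpha> a b)"
    by (rule ag_group.ex_comm_group_twist)
next
  fix G :: "'a monoid" and H :: "'b monoid" and \<alpha> \<beta>
  assume *: "comm_group G \<and> involutive_auto G \<alpha> \<and> comm_group H \<and> involutive_auto H \<beta>"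
  have "G \<cong> H" if "conjugate_autos G \<alpha> H \<beta>"
    using that by (auto simp: conjugate_autos_def is_iso_def)
  then show "ag_isomorphic (carrier G) (twist G \<alpha>) (carrier H) (twist H \<beta>) \<longleftrightarrow>
      G \<cong> H \<and> conjugate_autos G \<alpha> H \<beta>"
    using * ag_isomorphic_twist_iff by blast
qed

end
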